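(* Let $(V,\cdot,\phi)$ be an involutive hom-left-symmetric algebra with dual space $V^*$, and let $V\oplus V^*$ be the hom-Lie algebra with $$\Phi(u,a^* )=(\phi(u),\phi^*(a^* )),\qquad [(u,a^* ),(v,b^* )]=\big(u\cdot v-v\cdot u,\ \widetilde{L}_{\phi(u)}b^*-\widetilde{L}_{\phi(v)}a^*\big)$$ for $u,v\in V$, $a^*,b^*\in V^*$. Consider the non-degenerate bilinear form $\Omega_{V\oplus V^*}$ on $V\oplus V^*$ given by $$\Omega_{V\oplus V^*}\big((u,a^* ),(v,b^* )\big)=b^*(u)-a^*(v),\qquad u,v\in V,\ a^*,b^*\in V^*.$$ Then $V\oplus V^*$, with this form, is a phase space (of the hom-Lie algebra $V$ with its commutator bracket).
   Context: A hom-algebra $(V,\cdot,\phi)$ is a vector space $V$ with a bilinear product $\cdot$ and a linear map $\phi:V\to V$ with $\phi(u\cdot v)=\phi(u)\cdot\phi(v)$. It is hom-left-symmetric if $(u\cdot v)\cdot\phi(w)-\phi(u)\cdot(v\cdot w)=(v\cdot u)\cdot\phi(w)-\phi(v)\cdot(u\cdot w)$ for all $u,v,w$, and involutive if $\phi^2=\mathrm{Id}$. With commutator $[u,v]=u\cdot v-v\cdot u$, $(V,[\cdot,\cdot],\phi)$ is then a hom-Lie algebra, where a hom-Lie algebra is a triple $(\mathfrak{g},[\cdot,\cdot],\phi)$ with $[\cdot,\cdot]$ bilinear and skew ($[u,v]=-[v,u]$), $\phi$ linear with $\phi([u,v])=[\phi(u),\phi(v)]$, and $[\phi(u),[v,w]]+[\phi(v),[w,u]]+[\phi(w),[u,v]]=0$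 for all $u,v,w$; it is regular if $\phi$ is invertible. Elements of $V^*$ are written $a^*,b^*,\dots$; $\phi^*=\phi^t$ is the dual map, $\phi^*(a^* )=a^*\circ\phi$. For $u\in V$, $L_u v=u\cdot v$, and $\widetilde{L}_u:V^*\to V^*$ is given by $(\widetilde{L}_u a^* )(v)=-a^*(u\cdot v)$. A symplectic structure on a regular hom-Lie algebra $(\mathfrak{g},[\cdot,\cdot],\phi)$ is a skew-symmetric non-degenerate bilinear form $\omega$ with $\omega([u,v],\phi(w))+\omega([w,u],\phi(v))+\omega([v,w],\phi(u))=0$ and $\omega(\phi(u),\phi(v))=\omega(u,v)$ for all $u,v,w$. A phase space of a hom-Lie algebra $(\mathfrak{g},[\cdot,\cdot],\phi)$ is a hom-Lie algebra structure $(\mathfrak{g}\oplus\mathfrak{g}^*,[\cdot,\cdot]_{\mathfrak{g}\oplus\mathfrak{g}^*},\phi\oplus\phi^* )$ for which the form $\omega\big((u,a^* ),(v,b^* )\big)=b^*(u)-a^*(v)$ is a symplectic structure. *)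

theory Defs
  imports Complex_Main "HOL-Library.Function_Algebras" "HOL-Library.Product_Plus"
begin

(* The underlying vector space of an algebra is a subspace A of an ambient space, since the
   dual space V* is a proper subset of the type of all functions from V to the field. *)

definition linear_on ::
  "('a \<Rightarrow> 'b \<Rightarrow> 'b) \<Rightarrow> 'b set \<Rightarrow> ('a \<Rightarrow> 'c \<Rightarrow> 'c) \<Rightarrow> ('b::plus \<Rightarrow> 'c::plus) \<Rightarrow> bool"
  where "linear_on s A t f \<longleftrightarrow>
    (\<forall>x\<in>A. \<forall>y\<in>A. f (x + y) = f x + f y) \<and> (\<forall>c. \<forall>x\<in>A. f (s c x) = t c (f x))"

definition bilinear_on ::
  "('a \<Rightarrow> 'b \<Rightarrow> 'b) \<Rightarrow> 'b set \<Rightarrow> ('a \<Rightarrow> 'c \<Rightarrow> 'c) \<Rightarrow> ('b::plus \<Rightarrow> 'b \<Rightarrow> 'c::plus) \<Rightarrow> bool"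
  where "bilinear_on s A t f \<longleftrightarrow>
    (\<forall>x\<in>A. linear_on s A t (\<lambda>y. f x y) \<and> linear_on s A t (\<lambda>y. f y x))"

locale hom_algebra = vector_space scale
  for scale :: "'a::field \<Rightarrow> 'b::ab_group_add \<Rightarrow> 'b" +
  fixes A :: "'b set"
    and prd :: "'b \<Rightarrow> 'b \<Rightarrow> 'b"
    and phi :: "'b \<Rightarrow> 'b"
  assumes subspace_carrier: "subspace A"
    and prd_closed: "\<And>u v. u \<in> A \<Longrightarrow> v \<in> A \<Longrightarrow> prd u v \<in> A"
    and prd_bilinear: "bilinear_on scale A scale prd"
    and phi_closed: "\<And>u. u \<in> A \<Longrightarrow> phi u \<in> A"
    and phi_linear: "linear_on scale A scale phi"
    and phi_prd: "\<And>u v. u \<in> A \<Longrightarrow> v \<in> A \<Longrightarrow> phi (prd u v) = prd (phi u) (phi v)"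

locale hom_left_symmetric_algebra = hom_algebra +
  assumes hom_left_symmetric: "\<And>u v w. u \<in> A \<Longrightarrow> v \<in> A \<Longrightarrow> w \<in> A \<Longrightarrow>
    prd (prd u v) (phi w) - prd (phi u) (prd v w) =
    prd (prd v u) (phi w) - prd (phi v) (prd u w)"

locale involutive_hom_left_symmetric_algebra = hom_left_symmetric_algebra +
  assumes involutive: "\<And>u. u \<in> A \<Longrightarrow> phi (phi u) = u"

locale hom_lie_algebra = hom_algebra +
  assumes skew: "\<And>u v. u \<in> A \<Longrightarrow> v \<in> A \<Longrightarrow> prd u v = - prd v u"
    and hom_jacobi: "\<And>u v w. u \<in> A \<Longrightarrow> v \<in> A \<Longrightarrow> w \<in> A \<Longrightarrow>
      prd (phi u) (prd v w) + prd (phi v) (prd w u) + prd (phi w) (prd u v) = 0"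

locale regular_hom_lie_algebra = hom_lie_algebra +
  assumes regular: "bij_betw phi A A"

locale symplectic_hom_lie_algebra = regular_hom_lie_algebra scale A br phi
  for scale :: "'a::field \<Rightarrow> 'b::ab_group_add \<Rightarrow> 'b" and A br phi +
  fixes \<omega> :: "'b \<Rightarrow> 'b \<Rightarrow> 'a"
  assumes form_bilinear: "bilinear_on scale A (*) \<omega>"
    and form_skew: "\<And>u v. u \<in> A \<Longrightarrow> v \<in> A \<Longrightarrow> \<omega> u v = - \<omega> v u"
    and form_nondegenerate: "\<And>u. u \<in> A \<Longrightarrow> (\<And>v. v \<in> A \<Longrightarrow> \<omega> u v = 0) \<Longrightarrow> u = 0"
    and form_closed: "\<And>u v w. u \<in> A \<Longrightarrow> v \<in> A \<Longrightarrow> w \<in> A \<Longrightarrow>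
      \<omega> (br u v) (phi w) + \<omega> (br w u) (phi v) + \<omega> (br v w) (phi u) = 0"
    and form_invariant: "\<And>u v. u \<in> A \<Longrightarrow> v \<in> A \<Longrightarrow> \<omega> (phi u) (phi v) = \<omega> u v"

(* From here on the vector space V is the whole type 'b. *)

definition dual_space :: "('a::field \<Rightarrow> 'b::ab_group_add \<Rightarrow> 'b) \<Rightarrow> ('b \<Rightarrow> 'a) set"
  where "dual_space scale = {f. Vector_Spaces.linear scale (*) f}"

definition dual_map :: "('b \<Rightarrow> 'b) \<Rightarrow> ('b \<Rightarrow> 'a) \<Rightarrow> ('b \<Rightarrow> 'a)"
  where "dual_map phi f = f \<circ> phi"

definition sum_dual :: "('a::field \<Rightarrow> 'b::ab_group_add \<Rightarrow> 'b) \<Rightarrow> ('b \<times> ('b \<Rightarrow> 'a)) set"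
  where "sum_dual scale = UNIV \<times> dual_space scale"

definition scale_sum ::
  "('a::field \<Rightarrow> 'b::ab_group_add \<Rightarrow> 'b) \<Rightarrow> 'a \<Rightarrow> 'b \<times> ('b \<Rightarrow> 'a) \<Rightarrow> 'b \<times> ('b \<Rightarrow> 'a)"
  where "scale_sum scale c = (\<lambda>(u, f). (scale c u, \<lambda>v. c * f v))"

definition phi_sum :: "('b \<Rightarrow> 'b) \<Rightarrow> 'b \<times> ('b \<Rightarrow> 'a) \<Rightarrow> 'b \<times> ('b \<Rightarrow> 'a)"
  where "phi_sum phi = (\<lambda>(u, f). (phi u, dual_map phi f))"

definition canonical_form :: "'b \<times> ('b \<Rightarrow> 'a::field) \<Rightarrow> 'b \<times> ('b \<Rightarrow> 'a) \<Rightarrow> 'a"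
  where "canonical_form = (\<lambda>(u, f) (v, g). g u - f v)"

definition phase_space ::
  "('a::field \<Rightarrow> 'b::ab_group_add \<Rightarrow> 'b) \<Rightarrow> ('b \<Rightarrow> 'b \<Rightarrow> 'b) \<Rightarrow> ('b \<Rightarrow> 'b)
   \<Rightarrow> ('b \<times> ('b \<Rightarrow> 'a) \<Rightarrow> 'b \<times> ('b \<Rightarrow> 'a) \<Rightarrow> 'b \<times> ('b \<Rightarrow> 'a)) \<Rightarrow> bool"
  where "phase_space scale br phi br_sum \<longleftrightarrow>
    hom_lie_algebra scale UNIV br phi \<and>
    symplectic_hom_lie_algebra (scale_sum scale) (sum_dual scale) br_sum (phi_sum phi)
      canonical_form"

definition commutator :: "('b \<Rightarrow> 'b \<Rightarrow> 'b) \<Rightarrow> 'b \<Rightarrow> 'b \<Rightarrow> 'b::ab_group_add"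
  where "commutator prd u v = prd u v - prd v u"

definition Ltilde :: "('b \<Rightarrow> 'b \<Rightarrow> 'b) \<Rightarrow> 'b \<Rightarrow> ('b \<Rightarrow> 'a) \<Rightarrow> 'b \<Rightarrow> 'a::ab_group_add"
  where "Ltilde prd u f = (\<lambda>v. - f (prd u v))"

definition bracket_sum ::
  "('b::ab_group_add \<Rightarrow> 'b \<Rightarrow> 'b) \<Rightarrow> ('b \<Rightarrow> 'b)
   \<Rightarrow> 'b \<times> ('b \<Rightarrow> 'a::field) \<Rightarrow> 'b \<times> ('b \<Rightarrow> 'a) \<Rightarrow> 'b \<times> ('b \<Rightarrow> 'a)"
  where "bracket_sum prd phi = (\<lambda>(u, f) (v, g).
    (prd u v - prd v u, Ltilde prd (phi u) g - Ltilde prd (phi v) f))"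

end

theory Submission
  imports Defs
begin

text \<open>
  Everything reduces to identities in \<open>V\<close> by pairing with an arbitrary functional.

  On \<open>V\<close> itself, the hom-left-symmetric identity says that the hom-associator is symmetric in its
  first two arguments, so the alternating sum of hom-associators, which up to sign is the
  hom-Jacobi expression of the commutator, cancels (\<open>commutator_hom_lie_algebra\<close>).

  On \<open>V \<oplus> V\<^sup>*\<close>, the bracket is that of a semidirect product. Its hom-Jacobi identity in the dual
  component splits into three summands, one for each of the functionals involved. Each of these is
  the condition that \<open>u \<mapsto> Ltilde (\<phi> u)\<close> be a representation of the commutator algebra twisted by
  the dual of \<open>\<phi>\<close>; transposed to \<open>V\<close>, it is the hom-left-symmetric identity again
  (\<open>Ltilde_representation\<close>). Involutivity enters because \<open>\<phi>\<close> occurs both in the action and in the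
  transpose, and the two occurrences must cancel: \<open>\<phi>\<^sup>2 = Id\<close> makes \<open>\<Phi>\<close> multiplicative,
  bijective and \<open>\<Omega>\<close>-preserving.

  Closedness of \<open>\<Omega>\<close> holds because \<open>\<phi>\<close> is multiplicative: in the cyclic sum, the functional of
  the third element is applied to \<open>\<phi> [u, v] - \<phi> u \<cdot> \<phi> v + \<phi> v \<cdot> \<phi> u = 0\<close>, where \<open>u\<close> and \<open>v\<close> are
  the \<open>V\<close>-components of the other two, and likewise for the other functionals. Nondegeneracy is the fact
  that the linear functionals separate the points of a vector space.
\<close>

section \<open>The commutator of a hom-left-symmetric algebra\<close>

context hom_algebra
begin

lemma prd_add_left: "u \<in> A \<Longrightarrow> v \<in> A \<Longrightarrow> w \<in> A \<Longrightarrow> prd (u + v) w = prd u w + prd v w"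
  and prd_add_right: "u \<in> A \<Longrightarrow> v \<in> A \<Longrightarrow> w \<in> A \<Longrightarrow> prd w (u + v) = prd w u + prd w v"
  and prd_scale_left: "u \<in> A \<Longrightarrow> w \<in> A \<Longrightarrow> prd (scale c u) w = scale c (prd u w)"
  and prd_scale_right: "u \<in> A \<Longrightarrow> w \<in> A \<Longrightarrow> prd w (scale c u) = scale c (prd w u)"
  using prd_bilinear by (simp_all add: bilinear_on_def linear_on_def)

lemma phi_add: "u \<in> A \<Longrightarrow> v \<in> A \<Longrightarrow> phi (u + v) = phi u + phi v"
  and phi_scale: "u \<in> A \<Longrightarrow> phi (scale c u) = scale c (phi u)"
  using phi_linear by (simp_all add: linear_on_def)

lemma prd_diff_left: "u \<in> A \<Longrightarrow> v \<in> A \<Longrightarrow> w \<in> A \<Longrightarrow> prd (u - v) w = prd u w - prd v w"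
  using prd_add_left[of "u - v" v w] subspace_diff[OF subspace_carrier, of u v]
  by (simp add: algebra_simps)

lemma prd_diff_right: "u \<in> A \<Longrightarrow> v \<in> A \<Longrightarrow> w \<in> A \<Longrightarrow> prd w (u - v) = prd w u - prd w v"
  using prd_add_right[of "u - v" v w] subspace_diff[OF subspace_carrier, of u v]
  by (simp add: algebra_simps)

lemma phi_diff: "u \<in> A \<Longrightarrow> v \<in> A \<Longrightarrow> phi (u - v) = phi u - phi v"
  using phi_add[of "u - v" v] subspace_diff[OF subspace_carrier, of u v]
  by (simp add: algebra_simps)

end

text \<open>
  Up to sign, the hom-Jacobi expression of the commutator is the alternating sum of the hom-associator over
  all permutations of its arguments, hence vanishes if the hom-associator is symmetric in the
  first two.
\<close>

lemma (in hom_left_symmetric_algebra) commutator_hom_lie_algebra: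
  "hom_lie_algebra scale A (commutator prd) phi"
proof unfold_locales
  show "subspace A" by (rule subspace_carrier)
  show "commutator prd u v \<in> A" if "u \<in> A" "v \<in> A" for u v
    using that by (simp add: commutator_def prd_closed subspace_diff[OF subspace_carrier])
  show "bilinear_on scale A scale (commutator prd)"
    by (simp add: bilinear_on_def linear_on_def commutator_def prd_add_left prd_add_right
        prd_scale_left prd_scale_right scale_right_diff_distrib)
  show "phi u \<in> A" if "u \<in> A" for u using that by (rule phi_closed)
  show "linear_on scale A scale phi" by (rule phi_linear)
  show "phi (commutator prd u v) = commutator prd (phi u) (phi v)" if "u \<in> A" "v \<in> A" for u v
    using that by (simp add: commutator_def phi_diff phi_prd prd_closed)
  show "commutator prd u v = - commutator prd v u" if "u \<in> A" "v \<in> A" for u v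
    by (simp add: commutator_def)
  show "commutator prd (phi u) (commutator prd v w) + commutator prd (phi v) (commutator prd w u)
      + commutator prd (phi w) (commutator prd u v) = 0"
    if "u \<in> A" "v \<in> A" "w \<in> A" for u v w
  proof -
    define D where "D u v w = prd (prd u v) (phi w) - prd (phi u) (prd v w)
      - (prd (prd v u) (phi w) - prd (phi v) (prd u w))" for u v w
    have "D u v w = 0" "D v w u = 0" "D w u v = 0"
      using that hom_left_symmetric[of u v w] hom_left_symmetric[of v w u]
        hom_left_symmetric[of w u v]
      by (simp_all add: D_def)
    moreover have "commutator prd (phi u) (commutator prd v w)
        + commutator prd (phi v) (commutator prd w u)
        + commutator prd (phi w) (commutator prd u v) = - (D u v w + D v w u + D w u v)"
      using that
      by (simp add: commutator_def D_def prd_diff_left prd_diff_right prd_closed phi_closed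
          algebra_simps)
    ultimately show ?thesis by simp
  qed
qed

section \<open>The vector space underlying the phase space\<close>

context vector_space
begin

lemma dual_space_iff:
  "f \<in> dual_space scale \<longleftrightarrow>
    (\<forall>x y. f (x + y) = f x + f y) \<and> (\<forall>c x. f (scale c x) = c * f x)"
proof -
  have "vector_space ((*) :: 'a \<Rightarrow> 'a \<Rightarrow> 'a)"
    by unfold_locales (simp_all add: algebra_simps)
  then show ?thesis
    by (simp add: dual_space_def Vector_Spaces.linear_iff vector_space_axioms)
qed

text \<open>
  A nonzero vector is a linearly independent family, so it extends to a basis, and the functional
  dual to it takes the value 1 there.
\<close>

lemma dual_space_separates:
  assumes "\<And>f. f \<in> dual_space scale \<Longrightarrow> f u = 0"
  shows "u = 0"
proof (rule ccontr)
  assume "u \<noteq> 0"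
  interpret field: vector_space "(*) :: 'a \<Rightarrow> 'a \<Rightarrow> 'a"
    by unfold_locales (simp_all add: algebra_simps)
  interpret pair: vector_space_pair scale "(*) :: 'a \<Rightarrow> 'a \<Rightarrow> 'a" ..
  have "independent {u}" using \<open>u \<noteq> 0\<close> by simp
  then obtain f where "Vector_Spaces.linear scale (*) f" "f u = 1"
    using pair.linear_independent_extend[of "{u}" "\<lambda>_. 1"] by auto
  with assms[of f] show False by (simp add: dual_space_def)
qed

lemma vector_space_scale_sum: "vector_space (scale_sum scale)"
  by unfold_locales
    (auto simp: scale_sum_def fun_eq_iff scale_right_distrib scale_left_distrib algebra_simps)

lemma subspace_sum_dual: "module.subspace (scale_sum scale) (sum_dual scale)"
proof -
  interpret S: vector_space "scale_sum scale" by (rule vector_space_scale_sum)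
  show ?thesis
    by (auto simp: S.subspace_def sum_dual_def dual_space_iff scale_sum_def zero_prod_def
        algebra_simps)
qed

end

section \<open>The bracket on the sum with the dual space\<close>

context
  fixes scale :: "'a::field \<Rightarrow> 'b::ab_group_add \<Rightarrow> 'b" and prd phi
  assumes involutive_hlsa: "involutive_hom_left_symmetric_algebra scale UNIV prd phi"
begin

interpretation involutive_hom_left_symmetric_algebra scale UNIV prd phi
  by (rule involutive_hlsa)

lemmas prd_linear_simps =
  prd_add_left[simplified] prd_add_right[simplified]
  prd_scale_left[simplified] prd_scale_right[simplified]
  prd_diff_left[simplified] prd_diff_right[simplified]
  phi_add[simplified] phi_scale[simplified] phi_diff[simplified]

lemmas phi_prd_simps = phi_prd[simplified] involutive[simplified]

lemma dual_space_diff: "f \<in> dual_space scale \<Longrightarrow> f (x - y) = f x - f y"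
  by (metis add_diff_cancel diff_add_cancel dual_space_iff)

lemma dual_map_closed: "f \<in> dual_space scale \<Longrightarrow> dual_map phi f \<in> dual_space scale"
  by (simp add: dual_space_iff dual_map_def prd_linear_simps)

lemma Ltilde_diff_closed:
  "f \<in> dual_space scale \<Longrightarrow> g \<in> dual_space scale \<Longrightarrow>
    Ltilde prd u g - Ltilde prd v f \<in> dual_space scale"
  by (simp add: dual_space_iff Ltilde_def prd_linear_simps algebra_simps)

text \<open>
  The action of \<open>V\<close> on its dual space by \<open>Ltilde (phi u)\<close> is compatible with the commutator. The
  left-hand side, evaluated at \<open>t\<close>, is \<open>f\<close> applied to \<open>\<phi> v \<cdot> (u \<cdot> t) - \<phi> u \<cdot> (v \<cdot> t)\<close>. On the
  right, the \<open>\<phi>\<close> from the dual map moves onto both factors and \<open>\<phi>\<^sup>2 = Id\<close> cancels it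
  on the commutator, which leaves \<open>f\<close> applied to \<open>- [u, v] \<cdot> \<phi> t\<close>.
\<close>

lemma Ltilde_representation:
  assumes "f \<in> dual_space scale"
  shows "Ltilde prd u (Ltilde prd (phi v) f) t - Ltilde prd v (Ltilde prd (phi u) f) t =
    Ltilde prd (phi (prd u v - prd v u)) (dual_map phi f) t"
proof -
  have "prd (phi v) (prd u t) - prd (phi u) (prd v t) = - prd (prd u v - prd v u) (phi t)"
    using hom_left_symmetric[of u v t] by (simp add: prd_linear_simps algebra_simps)
  then have "f (prd (phi v) (prd u t)) - f (prd (phi u) (prd v t))
      = - f (prd (prd u v - prd v u) (phi t))"
    using dual_space_diff[OF assms] by (metis diff_0 diff_self)
  then show ?thesis
    by (simp add: Ltilde_def dual_map_def phi_prd_simps)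
qed

lemma Ltilde_linear:
  assumes "f \<in> dual_space scale"
  shows "Ltilde prd (u + v) f t = Ltilde prd u f t + Ltilde prd v f t"
    and "Ltilde prd (scale c u) f t = c * Ltilde prd u f t"
  using assms by (simp_all add: Ltilde_def dual_space_iff prd_linear_simps)

lemma bracket_sum_hom_algebra:
  "hom_algebra (scale_sum scale) (sum_dual scale) (bracket_sum prd phi) (phi_sum phi)"
proof -
  interpret S: vector_space "scale_sum scale" by (rule vector_space_scale_sum)
  show ?thesis
  proof unfold_locales
    show "S.subspace (sum_dual scale)" by (rule subspace_sum_dual)
    show "bracket_sum prd phi x y \<in> sum_dual scale"
      if "x \<in> sum_dual scale" "y \<in> sum_dual scale" for x y
      using that by (auto simp: sum_dual_def bracket_sum_def Ltilde_diff_closed)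
    show "bilinear_on (scale_sum scale) (sum_dual scale) (scale_sum scale) (bracket_sum prd phi)"
      by (auto simp: bilinear_on_def linear_on_def sum_dual_def bracket_sum_def scale_sum_def
          fun_eq_iff prd_linear_simps Ltilde_linear scale_right_diff_distrib)
        (simp_all add: Ltilde_def algebra_simps)
    show "phi_sum phi x \<in> sum_dual scale" if "x \<in> sum_dual scale" for x
      using that by (auto simp: sum_dual_def phi_sum_def dual_map_closed)
    show "linear_on (scale_sum scale) (sum_dual scale) (scale_sum scale) (phi_sum phi)"
      by (auto simp: linear_on_def sum_dual_def scale_sum_def phi_sum_def dual_map_def fun_eq_iff
          prd_linear_simps)
    show "phi_sum phi (bracket_sum prd phi x y)
        = bracket_sum prd phi (phi_sum phi x) (phi_sum phi y)" for x y
      by (cases x; cases y) (simp add: phi_sum_def bracket_sum_def Ltilde_def dual_map_def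
          fun_eq_iff prd_linear_simps phi_prd_simps)
  qed
qed

text \<open>
  The component of the hom-Jacobi identity in \<open>V\<close> is that of the commutator. In the dual
  component, the terms that contain a fixed functional are exactly those of
  \<open>Ltilde_representation\<close>.
\<close>

lemma bracket_sum_hom_lie_algebra:
  "hom_lie_algebra (scale_sum scale) (sum_dual scale) (bracket_sum prd phi) (phi_sum phi)"
proof -
  interpret S: hom_algebra "scale_sum scale" "sum_dual scale" "bracket_sum prd phi" "phi_sum phi"
    by (rule bracket_sum_hom_algebra)
  interpret C: hom_lie_algebra scale UNIV "commutator prd" phi
    by (rule commutator_hom_lie_algebra)
  show ?thesis
  proof unfold_locales
    show "bracket_sum prd phi x y = - bracket_sum prd phi y x" for x y
      by (auto simp: bracket_sum_def split: prod.split)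
    fix x y z
    assume "x \<in> sum_dual scale" "y \<in> sum_dual scale" "z \<in> sum_dual scale"
    then obtain u f v g w h where xyz: "x = (u, f)" "y = (v, g)" "z = (w, h)"
      and dual: "f \<in> dual_space scale" "g \<in> dual_space scale" "h \<in> dual_space scale"
      by (auto simp: sum_dual_def)
    have Ltilde_diff: "Ltilde prd a (p - q) = Ltilde prd a p - Ltilde prd a q"
      for a and p q :: "'b \<Rightarrow> 'a"
      by (simp add: Ltilde_def fun_eq_iff)
    show "bracket_sum prd phi (phi_sum phi x) (bracket_sum prd phi y z) +
        bracket_sum prd phi (phi_sum phi y) (bracket_sum prd phi z x) +
        bracket_sum prd phi (phi_sum phi z) (bracket_sum prd phi x y) = 0"
      using C.hom_jacobi[of u v w]
        Ltilde_representation[OF dual(1), of v w] Ltilde_representation[OF dual(2), of w u]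
        Ltilde_representation[OF dual(3), of u v]
      by (simp add: xyz bracket_sum_def phi_sum_def commutator_def Ltilde_diff zero_prod_def
          phi_prd_simps fun_eq_iff algebra_simps)
  qed
qed

section \<open>The canonical symplectic form\<close>

lemma canonical_form_symplectic:
  "symplectic_hom_lie_algebra (scale_sum scale) (sum_dual scale) (bracket_sum prd phi)
    (phi_sum phi) canonical_form"
proof -
  interpret S: hom_lie_algebra "scale_sum scale" "sum_dual scale" "bracket_sum prd phi"
    "phi_sum phi"
    by (rule bracket_sum_hom_lie_algebra)
  show ?thesis
  proof unfold_locales
    have phi_sum_involutive: "phi_sum phi (phi_sum phi x) = x" for x :: "'b \<times> ('b \<Rightarrow> 'a)"
      by (auto simp: phi_sum_def dual_map_def phi_prd_simps split: prod.split)
    show "bij_betw (phi_sum phi) (sum_dual scale) (sum_dual scale)"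
      by (rule bij_betw_byWitness[where f' = "phi_sum phi"])
        (auto simp: phi_sum_involutive S.phi_closed)
    show "bilinear_on (scale_sum scale) (sum_dual scale) (*) canonical_form"
      by (auto simp: bilinear_on_def linear_on_def sum_dual_def canonical_form_def scale_sum_def
          dual_space_iff algebra_simps)
    show "canonical_form x y = - canonical_form y x" for x y :: "'b \<times> ('b \<Rightarrow> 'a)"
      by (simp add: canonical_form_def split: prod.split)
    show "x = 0" if x: "x \<in> sum_dual scale"
      and orth: "\<And>y. y \<in> sum_dual scale \<Longrightarrow> canonical_form x y = 0" for x
    proof -
      obtain u f where uf: "x = (u, f)" by fastforce
      have f0: "f v = 0" for v
        using orth[of "(v, 0)"] by (simp add: uf sum_dual_def dual_space_iff canonical_form_def)
      have "u = 0"
      proof (rule dual_space_separates)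
        fix g assume "g \<in> dual_space scale"
        then show "g u = 0"
          using orth[of "(0, g)"] f0 by (simp add: uf sum_dual_def canonical_form_def)
      qed
      with f0 show ?thesis by (simp add: uf zero_prod_def fun_eq_iff)
    qed
    show "canonical_form (bracket_sum prd phi x y) (phi_sum phi z) +
        canonical_form (bracket_sum prd phi z x) (phi_sum phi y) +
        canonical_form (bracket_sum prd phi y z) (phi_sum phi x) = 0"
      if "x \<in> sum_dual scale" "y \<in> sum_dual scale" "z \<in> sum_dual scale" for x y z
      using that
      by (auto simp: sum_dual_def canonical_form_def bracket_sum_def phi_sum_def dual_map_def
          Ltilde_def dual_space_diff prd_linear_simps phi_prd_simps)
    show "canonical_form (phi_sum phi x) (phi_sum phi y) = canonical_form x y"
      for x y :: "'b \<times> ('b \<Rightarrow> 'a)"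
      by (simp add: canonical_form_def phi_sum_def dual_map_def phi_prd_simps split: prod.split)
  qed
qed

end

theorem theorem4p9:
  fixes scale :: "'a::field \<Rightarrow> 'b::ab_group_add \<Rightarrow> 'b"
    and prd :: "'b \<Rightarrow> 'b \<Rightarrow> 'b"
    and phi :: "'b \<Rightarrow> 'b"
  assumes "involutive_hom_left_symmetric_algebra scale UNIV prd phi"
  shows "phase_space scale (commutator prd) phi (bracket_sum prd phi)"
proof -
  interpret involutive_hom_left_symmetric_algebra scale UNIV prd phi by (rule assms)
  show ?thesis
    unfolding phase_space_def
    using commutator_hom_lie_algebra canonical_form_symplectic[OF assms] by blast
qed

end
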